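(* For each integer $n\ge 2$, $$ \deg(P_n(z))=\sum_{k=1}^{n-2}\mathrm{Od}(k), $$ where $\mathrm{Od}(k)$ is the largest odd divisor of $k$.
   Context: For an integer $s\ge 0$, let $S_s(z)=\prod_{i=1}^{s}(1+z^i)$, with $S_0(z)=1$. For an integer $n\ge 2$ let $$ W_n(z) = 2\sum_{i=1}^{\left\lfloor\frac{n-1}{2}\right\rfloor} S_{n-i-2}(z)\,S_{i-1}(z)\,z^{n-i-1} + \left(S_{\left\lfloor\frac{n-2}{2}\right\rfloor}(z)\right)^2 \quad\text{and}\quad D_n(z)=\prod_{j\ge 1} S_{\left\lfloor\frac{n-2}{2^j}\right\rfloor}(z). $$ $P_n(z)$ denotes the quotient $W_n(z)/D_n(z)$, i.e. the polynomial such that $W_n(z)=P_n(z)D_n(z)$. An empty sum equals $0$. *)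

theory Defs
  imports "HOL-Computational_Algebra.Polynomial" "HOL-Library.Groups_Big_Fun"
begin

definition S_poly :: "nat \<Rightarrow> int poly" where
  "S_poly s = (\<Prod>i=1..s. 1 + monom 1 i)"

(* The natural-number subtractions do not truncate for n \<ge> 2: the sum is empty for n = 2, and
   for n \<ge> 3 every i in the range satisfies i + 2 \<le> n. *)
definition W_poly :: "nat \<Rightarrow> int poly" where
  "W_poly n =
     2 * (\<Sum>i=1..(n - 1) div 2. S_poly (n - i - 2) * S_poly (i - 1) * monom 1 (n - i - 1))
     + (S_poly ((n - 2) div 2))\<^sup>2"

(* The infinite product over j \<ge> 1, with the index shifted by one; Prod_any multiplies the
   factors different from 1 and would be 1 by convention if there were infinitely many of them,
   which finite_D_poly_factors excludes. *)
definition D_poly :: "nat \<Rightarrow> int poly" where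
  "D_poly n = (\<Prod>j. S_poly ((n - 2) div 2 ^ Suc j))"

lemma finite_D_poly_factors: "finite {j. S_poly ((n - 2) div 2 ^ Suc j) \<noteq> 1}"
proof (rule finite_subset)
  show "{j. S_poly ((n - 2) div 2 ^ Suc j) \<noteq> 1} \<subseteq> {..n}"
  proof (rule subsetI, rule ccontr)
    fix j assume j: "j \<in> {j. S_poly ((n - 2) div 2 ^ Suc j) \<noteq> 1}" "j \<notin> {..n}"
    have "n - 2 < 2 ^ Suc j"
      using j(2) less_exp[of "Suc j"] by simp
    then have "(n - 2) div 2 ^ Suc j = 0"
      by (rule div_less)
    then show False
      using j(1) by (simp add: S_poly_def)
  qed
qed simp

(* The exact quotient W_poly n / D_poly n. It is unique because D_poly n is nonzero. Polynomial
   division with remainder is avoided here because it would give a polynomial even if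
   D_poly n did not divide W_poly n. *)
definition P_poly :: "nat \<Rightarrow> int poly" where
  "P_poly n = (THE P. W_poly n = P * D_poly n)"

definition Od :: "nat \<Rightarrow> nat" where
  "Od k = Max {d. odd d \<and> d dvd k}"

end

(* Every summand of W_n is already divisible by D_n.  Put m = n - 2 and let z be a complex number
   some power of which is -1, with e the least exponent such that z^e = -1.  Then z^k = -1 exactly
   for the odd multiples k of e, so z is a root of S_s of multiplicity ((s div e) + 1) div 2 and a
   root of D_n of multiplicity m div (2e).  Comparing floors shows that D_n divides S_a S_b over
   the complex numbers whenever m <= a + b + 1, and over the integers because D_n is monic.  For
   the degrees, the summand i = 1 alone attains deg W_n = m(m+1)/2, while splitting 1, ..., m by
   parity gives the same recursion for m(m+1)/2 - deg D_n as for the sum of Od. *)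
theory Submission
  imports Defs "HOL-Computational_Algebra.Fundamental_Theorem_Algebra"
begin

section \<open>Divisibility of complex and integer polynomials\<close>

text \<open>A complex polynomial is its leading coefficient times the product of its linear factors,
  so inclusion of root multisets yields divisibility.\<close>

lemma complex_poly_dvdI:
  fixes p q :: "complex poly"
  assumes "p \<noteq> 0" "q \<noteq> 0" and "\<And>z. order z p \<le> order z q"
  shows "p dvd q"
proof -
  have "proots p \<subseteq># proots q"
    using assms by (auto simp: subseteq_mset_def)
  then have "image_mset (\<lambda>z. [:-z, 1:]) (proots p) \<subseteq># image_mset (\<lambda>z. [:-z, 1:]) (proots q)"
    by (rule image_mset_subseteq_mono)
  then have "(\<Prod>z\<in>#proots p. [:-z, 1:]) dvd (\<Prod>z\<in>#proots q. [:-z, 1:])"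
    by (rule prod_mset_subset_imp_dvd)
  then have "smult (lead_coeff p) (\<Prod>z\<in>#proots p. [:-z, 1:])
      dvd smult (lead_coeff q) (\<Prod>z\<in>#proots q. [:-z, 1:])"
    using assms by (simp add: smult_dvd_iff dvd_smult)
  then show ?thesis
    by (simp only: complex_poly_decompose_multiset)
qed

section \<open>Descent of divisibility from the complex numbers to the integers\<close>

abbreviation complex_poly_of_int :: "int poly \<Rightarrow> complex poly" where
  "complex_poly_of_int \<equiv> map_poly of_int"

lemma complex_poly_of_int_add:
  "complex_poly_of_int (p + q) = complex_poly_of_int p + complex_poly_of_int q"
  by (intro poly_eqI) (simp add: coeff_map_poly)

lemma complex_poly_of_int_mult:
  "complex_poly_of_int (p * q) = complex_poly_of_int p * complex_poly_of_int q"
  by (intro poly_eqI) (simp add: coeff_map_poly coeff_mult)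

lemma complex_poly_of_int_prod:
  "complex_poly_of_int (prod f A) = (\<Prod>x\<in>A. complex_poly_of_int (f x))"
  by (induction A rule: infinite_finite_induct)
     (simp_all add: complex_poly_of_int_mult map_poly_1)

lemma degree_complex_poly_of_int: "degree (complex_poly_of_int p) = degree p"
  by (rule degree_map_poly) auto

lemma complex_poly_of_int_eq_0_iff: "complex_poly_of_int p = 0 \<longleftrightarrow> p = 0"
  by (simp add: poly_eq_iff coeff_map_poly)

text \<open>Pseudo-division scales by a power of the leading coefficient, here 1, so it is true
  division over the integers. Over the complex numbers \<open>d\<close> divides the remainder, whose
  smaller degree forces it to be 0.\<close>

lemma dvd_if_complex_poly_dvd:
  assumes monic: "lead_coeff d = 1" and dvd: "complex_poly_of_int d dvd complex_poly_of_int p"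
  shows "d dvd p"
proof -
  obtain q r where qr: "pseudo_divmod p d = (q, r)"
    by fastforce
  have "d \<noteq> 0"
    using monic by auto
  then have p: "p = d * q + r" and r: "r = 0 \<or> degree r < degree d"
    using pseudo_divmod[OF _ qr] monic by auto
  have "complex_poly_of_int d dvd complex_poly_of_int r"
    using dvd unfolding p complex_poly_of_int_add complex_poly_of_int_mult
    by (simp add: dvd_add_right_iff)
  then have "degree d \<le> degree r" if "r \<noteq> 0"
    using that \<open>d \<noteq> 0\<close> dvd_imp_degree[of "complex_poly_of_int d" "complex_poly_of_int r"]
    by (simp only: degree_complex_poly_of_int complex_poly_of_int_eq_0_iff not_False_eq_True)
  then have "r = 0"
    using r by (auto simp: not_less[symmetric])
  then show ?thesis
    using p by simp
qed

section \<open>The polynomials $S_s$ and $D_n$\<close>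

lemma monic_one_plus_monom:
  assumes "k \<ge> 1"
  shows "degree (1 + monom 1 k :: int poly) = k" "lead_coeff (1 + monom 1 k :: int poly) = 1"
proof -
  show "degree (1 + monom 1 k :: int poly) = k"
    using assms by (subst degree_add_eq_right) (auto simp: degree_monom_eq)
  then show "lead_coeff (1 + monom 1 k :: int poly) = 1"
    using assms by simp
qed

lemma S_poly_0 [simp]: "S_poly 0 = 1"
  by (simp add: S_poly_def)

lemma lead_coeff_S_poly: "lead_coeff (S_poly s) = 1"
  unfolding S_poly_def lead_coeff_prod
  by (rule prod.neutral) (use monic_one_plus_monom(2) in auto)

lemma S_poly_nonzero [simp]: "S_poly s \<noteq> 0"
  using lead_coeff_S_poly[of s] by auto

lemma degree_S_poly: "2 * degree (S_poly s) = s * (s + 1)"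
proof (induction s)
  case (Suc s)
  have "S_poly (Suc s) = S_poly s * (1 + monom 1 (Suc s))"
    by (simp add: S_poly_def)
  moreover have "1 + monom 1 (Suc s) \<noteq> (0 :: int poly)"
    using monic_one_plus_monom(1)[of "Suc s"]
    by (metis degree_0 le_add1 nat.distinct(1) plus_1_eq_Suc)
  ultimately have "degree (S_poly (Suc s)) = degree (S_poly s) + Suc s"
    by (simp add: degree_mult_eq monic_one_plus_monom(1))
  then show ?case
    using Suc by (simp add: algebra_simps)
qed simp

text \<open>The product D_n in the variable m = n - 2, cut off at m factors: all later ones are 1
  because m < 2^(j+1) for j \<ge> m.\<close>

definition S_prod :: "nat \<Rightarrow> int poly" where
  "S_prod m = (\<Prod>j<m. S_poly (m div 2 ^ Suc j))"

lemma S_poly_div_eq_1: "N \<ge> m \<Longrightarrow> S_poly (m div 2 ^ Suc N) = 1"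
  using less_exp[of "Suc N"] by simp

lemma S_prod_superset: "N \<ge> m \<Longrightarrow> S_prod m = (\<Prod>j<N. S_poly (m div 2 ^ Suc j))"
  unfolding S_prod_def
  by (rule prod.mono_neutral_left) (auto intro!: S_poly_div_eq_1 simp del: power_Suc)

lemma D_poly_eq_S_prod: "D_poly n = S_prod (n - 2)"
  unfolding D_poly_def S_prod_def
  by (rule Prod_any.expand_superset)
     (use S_poly_div_eq_1[of "n - 2"] in \<open>auto simp: not_less[symmetric] simp del: power_Suc\<close>)

text \<open>Splitting off the first factor leaves the product for \<open>m div 2\<close>. This
  halving drives the inductions for root multiplicities and for degrees.\<close>

lemma S_prod_rec:
  assumes "m \<ge> 1"
  shows "S_prod m = S_poly (m div 2) * S_prod (m div 2)"
proof -
  obtain l where l: "m = Suc l"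
    using assms by (cases m) auto
  have "S_prod m = S_poly (m div 2) * (\<Prod>j<l. S_poly (m div 2 ^ Suc (Suc j)))"
    unfolding S_prod_def by (simp only: l prod.lessThan_Suc_shift comp_def) simp
  also have "(\<Prod>j<l. S_poly (m div 2 ^ Suc (Suc j))) = (\<Prod>j<l. S_poly (m div 2 div 2 ^ Suc j))"
    by (simp only: power_Suc[of 2 "Suc _"] div_mult2_eq)
  \<comment> \<open>The m - 1 factors left are at least \<open>m div 2\<close> many; any surplus
    ones are 1.\<close>
  also have "\<dots> = S_prod (m div 2)"
    by (rule S_prod_superset[symmetric]) (use l in linarith)
  finally show ?thesis .
qed

lemma lead_coeff_S_prod: "lead_coeff (S_prod m) = 1"
  by (simp add: S_prod_def lead_coeff_prod lead_coeff_S_poly)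

lemma S_prod_nonzero [simp]: "S_prod m \<noteq> 0"
  using lead_coeff_S_prod[of m] by auto

section \<open>Multiplicities of the complex roots\<close>

text \<open>The derivative of 1 + z^k can vanish only at 0, which is not a root, so all roots are
  simple.\<close>

lemma order_one_plus_monom:
  fixes z :: complex
  assumes "k \<ge> 1"
  shows "order z (1 + monom 1 k) = (if z ^ k = -1 then 1 else 0)"
proof -
  have z: "poly (1 + monom 1 k) z = 0 \<longleftrightarrow> z ^ k = -1"
    by (simp add: poly_monom add_eq_0_iff)
  have nz: "1 + monom 1 k \<noteq> (0 :: complex poly)"
  proof
    assume "1 + monom 1 k = (0 :: complex poly)"
    then have "coeff (1 + monom 1 k) 0 = (0 :: complex)" by simp
    then show False using assms by simp
  qed
  have "rsquarefree (1 + monom 1 k :: complex poly)"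
    unfolding rsquarefree_roots
  proof (intro allI notI, elim conjE)
    fix a :: complex
    assume a: "poly (1 + monom 1 k) a = 0" "poly (pderiv (1 + monom 1 k)) a = 0"
    from a(2) assms have "a = 0"
      by (auto simp: pderiv_add pderiv_monom poly_monom)
    with a(1) assms show False
      by (simp add: poly_monom power_0_left)
  qed
  with z nz show ?thesis
    by (auto simp: order_root rsquarefree_root_order order_0I)
qed

lemma order_S_poly:
  "order z (complex_poly_of_int (S_poly s)) = card {k\<in>{1..s}. z ^ k = -1}"
proof (induction s)
  case (Suc s)
  have eq: "complex_poly_of_int (S_poly (Suc s)) =
      complex_poly_of_int (S_poly s) * (1 + monom 1 (Suc s))"
    by (simp add: S_poly_def complex_poly_of_int_mult complex_poly_of_int_add map_poly_1
        map_poly_monom)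
  have "{k\<in>{1..Suc s}. z ^ k = -1} =
      (if z ^ Suc s = -1 then insert (Suc s) {k\<in>{1..s}. z ^ k = -1} else {k\<in>{1..s}. z ^ k = -1})"
    by (auto simp: le_Suc_eq)
  moreover have "complex_poly_of_int (S_poly (Suc s)) \<noteq> 0"
    by (simp add: complex_poly_of_int_eq_0_iff)
  ultimately show ?case
    using Suc order_one_plus_monom[of "Suc s" z] unfolding eq
    by (simp add: order_mult del: power_Suc)
qed (simp add: map_poly_1 order_0I)

text \<open>With k = e q + r and r < e, z^k = (-1)^q z^r. Minimality of e rules out z^r = -1, and
  also z^r = 1 for r > 0, since then z^(e-r) = -1.\<close>

lemma power_eq_minus_one_iff:
  fixes z :: complex
  assumes e: "e \<ge> 1" "z ^ e = -1" and least: "\<And>k. k \<ge> 1 \<Longrightarrow> z ^ k = -1 \<Longrightarrow> e \<le> k"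
  shows "z ^ k = -1 \<longleftrightarrow> e dvd k \<and> odd (k div e)"
proof -
  define q r where "q = k div e" and "r = k mod e"
  have r: "r < e" and k: "k = e * q + r"
    using e by (auto simp: q_def r_def)
  have zk: "z ^ k = (-1) ^ q * z ^ r"
    by (simp add: k power_add power_mult e)
  have "z ^ r \<noteq> -1"
    using least[of r] r by (cases "r = 0") auto
  moreover have "z ^ r \<noteq> 1" if "r \<noteq> 0"
  proof
    assume "z ^ r = 1"
    moreover have "z ^ e = z ^ (e - r) * z ^ r"
      using r by (simp flip: power_add)
    ultimately have "z ^ (e - r) = -1"
      using e by simp
    with least[of "e - r"] r that show False by linarith
  qed
  ultimately have "z ^ k = -1 \<longleftrightarrow> r = 0 \<and> odd q"
    unfolding zk by (cases "even q") (auto simp: minus_equation_iff)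
  then show ?thesis
    by (simp add: q_def r_def dvd_eq_mod_eq_0)
qed

lemma card_odd_multiples:
  fixes e :: nat
  assumes "e \<ge> 1"
  shows "card {k\<in>{1..s}. e dvd k \<and> odd (k div e)} = (s div e + 1) div 2"
proof -
  have "{k\<in>{1..s}. e dvd k \<and> odd (k div e)} = (\<lambda>i. e * (2 * i + 1)) ` {..<(s div e + 1) div 2}"
    (is "?A = ?B")
  proof (intro equalityI subsetI)
    fix k assume "k \<in> ?A"
    then obtain i where k: "k = e * (2 * i + 1)" "k \<le> s"
      using assms by (auto elim!: oddE)
    have "2 * i + 1 \<le> s div e"
      using k assms by (simp add: less_eq_div_iff_mult_less_eq mult.commute)
    then show "k \<in> ?B"
      using k(1) by (intro image_eqI[of _ _ i]) auto
  next
    fix k assume "k \<in> ?B"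
    then obtain i where k: "k = e * (2 * i + 1)" "i < (s div e + 1) div 2"
      by auto
    have "2 * i + 1 \<le> s div e"
      using k(2) by linarith
    then have "k \<le> s"
      using k(1) assms by (simp add: less_eq_div_iff_mult_less_eq mult.commute)
    then show "k \<in> ?A"
      using k(1) assms by auto
  qed
  moreover have "inj_on (\<lambda>i. e * (2 * i + 1)) {..<(s div e + 1) div 2}"
    using assms by (auto simp: inj_on_def)
  ultimately show ?thesis
    by (simp add: card_image)
qed

text \<open>With q = \<open>m div 2 div e\<close>, the first factor of \<open>S_prod_rec\<close>
  contributes q/2 rounded up and the rest, by induction, q/2 rounded down.\<close>

lemma order_S_prod:
  assumes e: "e \<ge> 1"
    and order: "\<And>s. order z (complex_poly_of_int (S_poly s)) = (s div e + 1) div 2"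
  shows "order z (complex_poly_of_int (S_prod m)) = m div (2 * e)"
proof (induction m rule: less_induct)
  case (less m)
  show ?case
  proof (cases "m = 0")
    case True
    then show ?thesis by (simp add: S_prod_def map_poly_1 order_0I)
  next
    case False
    have "complex_poly_of_int (S_prod m) =
        complex_poly_of_int (S_poly (m div 2)) * complex_poly_of_int (S_prod (m div 2))"
      using False by (subst S_prod_rec) (auto simp: complex_poly_of_int_mult)
    then have "order z (complex_poly_of_int (S_prod m)) =
        (m div 2 div e + 1) div 2 + m div 2 div (2 * e)"
      using False less by (simp add: order_mult order complex_poly_of_int_eq_0_iff)
    also have "m div 2 div (2 * e) = m div 2 div e div 2"
      by (simp add: div_mult2_eq mult.commute)
    also have "(m div 2 div e + 1) div 2 + m div 2 div e div 2 = m div 2 div e"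
      by linarith
    finally show ?thesis
      by (simp add: div_mult2_eq)
  qed
qed

lemma div_two_mult_le:
  fixes a b e m :: nat
  assumes "e \<ge> 1" "m \<le> a + b + 1"
  shows "m div (2 * e) \<le> (a div e + 1) div 2 + (b div e + 1) div 2"
proof -
  define i j where "i = (a div e + 1) div 2" and "j = (b div e + 1) div 2"
  \<comment> \<open>With q = \<open>c div e\<close>, this combines c < e (q + 1) with q \<le> 2 ((q
    + 1) div 2). Adding the bounds for \<open>a\<close> and \<open>b\<close> gives m + 1 \<le> 2 e
    (i + j + 1).\<close>
  have bound: "c + 1 \<le> e * (2 * ((c div e + 1) div 2) + 1)" for c
  proof -
    have "c < e * (c div e + 1)"
      using assms(1) dividend_less_times_div[of e c] by simp
    also have "\<dots> \<le> e * (2 * ((c div e + 1) div 2) + 1)"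
      by (intro mult_left_mono) linarith+
    finally show ?thesis by simp
  qed
  have "m + 1 \<le> (a + 1) + (b + 1)"
    using assms by simp
  also have "\<dots> \<le> e * (2 * i + 1) + e * (2 * j + 1)"
    using bound[of a] bound[of b] unfolding i_def j_def by (rule add_mono)
  also have "\<dots> = (i + j + 1) * (2 * e)"
    by (simp add: algebra_simps)
  finally have "m div (2 * e) < i + j + 1"
    using assms(1) by (simp add: div_less_iff_less_mult)
  then show ?thesis
    by (simp add: i_def j_def)
qed

lemma S_prod_dvd:
  assumes "m \<le> a + b + 1"
  shows "S_prod m dvd S_poly a * S_poly b"
proof (rule dvd_if_complex_poly_dvd[OF lead_coeff_S_prod], rule complex_poly_dvdI)
  fix z :: complex
  have order_ab: "order z (complex_poly_of_int (S_poly a * S_poly b)) =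
      order z (complex_poly_of_int (S_poly a)) + order z (complex_poly_of_int (S_poly b))"
    by (simp add: complex_poly_of_int_mult order_mult complex_poly_of_int_eq_0_iff)
  show "order z (complex_poly_of_int (S_prod m)) \<le>
      order z (complex_poly_of_int (S_poly a * S_poly b))"
  proof (cases "\<exists>k\<ge>1. z ^ k = -1")
    case True
    define e where "e = (LEAST k. k \<ge> 1 \<and> z ^ k = -1)"
    have e: "e \<ge> 1" "z ^ e = -1" and least: "\<And>k. k \<ge> 1 \<Longrightarrow> z ^ k = -1 \<Longrightarrow> e \<le> k"
      using LeastI_ex[of "\<lambda>k. k \<ge> 1 \<and> z ^ k = -1"] True
      by (auto simp: e_def intro: Least_le)
    have S: "order z (complex_poly_of_int (S_poly s)) = (s div e + 1) div 2" for s
      by (simp only: order_S_poly power_eq_minus_one_iff[OF e least] card_odd_multiples[OF e(1)])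
    show ?thesis
      unfolding order_ab order_S_prod[OF e(1) S] S by (rule div_two_mult_le[OF e(1) assms])
  next
    \<comment> \<open>The multiplicity of z in each \<open>S_poly s\<close> then counts an empty
      set, so z is not a root of \<open>S_prod m\<close> either.\<close>
    case False
    then have "poly (complex_poly_of_int (S_poly s)) z \<noteq> 0" for s
      using order_S_poly[of z s] by (auto simp: order_root complex_poly_of_int_eq_0_iff)
    then have "poly (complex_poly_of_int (S_prod m)) z \<noteq> 0"
      by (simp add: S_prod_def complex_poly_of_int_prod poly_prod)
    then show ?thesis
      by (simp add: order_0I)
  qed
qed (simp_all add: complex_poly_of_int_eq_0_iff)

section \<open>Degrees\<close>

lemma D_poly_dvd_W_poly: "D_poly n dvd W_poly n"
proof -
  \<comment> \<open>The two indices add up to n - 3, so the bound in \<open>S_prod_dvd\<close> is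
    attained with equality.\<close>
  have "D_poly n dvd S_poly (n - i - 2) * S_poly (i - 1)" if "i \<in> {1..(n - 1) div 2}" for i
    unfolding D_poly_eq_S_prod using that by (intro S_prod_dvd) auto
  moreover have "D_poly n dvd (S_poly ((n - 2) div 2))\<^sup>2"
    unfolding D_poly_eq_S_prod power2_eq_square by (intro S_prod_dvd) linarith
  ultimately show ?thesis
    unfolding W_poly_def by (blast intro: dvd_add dvd_mult dvd_sum dvd_mult2)
qed

text \<open>The monomial raises the triangular number a(a+1)/2 to the next one, so each summand has
  a sum of two triangular numbers as its degree.\<close>

lemma degree_W_poly_summand:
  "2 * degree (S_poly a * S_poly b * monom 1 (Suc a)) = (a + 1) * (a + 2) + b * (b + 1)"
  using degree_S_poly[of a] degree_S_poly[of b]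
  by (simp add: degree_mult_eq degree_monom_eq monom_eq_0_iff algebra_simps)

lemma degree_W_poly:
  assumes "n \<ge> 2"
  shows "W_poly n \<noteq> 0" "2 * degree (W_poly n) = (n - 2) * (n - 1)"
proof -
  have "W_poly n \<noteq> 0 \<and> 2 * degree (W_poly n) = (n - 2) * (n - 1)"
  proof (cases "n = 2")
    case True
    then show ?thesis by (simp add: W_poly_def)
  next
    case False
    define m where "m = n - 3"
    have n: "n = m + 3"
      using assms False by (simp add: m_def)
    define f where "f i = S_poly (n - i - 2) * S_poly (i - 1) * monom 1 (n - i - 1)" for i
    define r where "r = 2 * (\<Sum>i=2..(n - 1) div 2. f i) + (S_poly ((n - 2) div 2))\<^sup>2"
    have "(\<Sum>i=1..(n - 1) div 2. f i) = f 1 + (\<Sum>i=2..(n - 1) div 2. f i)"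
      using n by (subst sum.atLeast_Suc_atMost) (simp_all flip: numeral_2_eq_2)
    then have W: "W_poly n = 2 * f 1 + r"
      by (simp add: W_poly_def r_def f_def algebra_simps)
    have numeral: "2 * p = smult 2 p" for p :: "int poly"
      by (simp add: numeral_poly)
    have deg_f: "2 * degree (f i) = (n - i - 1) * (n - i) + (i - 1) * i"
      if "1 \<le> i" "i \<le> (n - 1) div 2" for i
    proof -
      have "n - i - 1 = Suc (n - i - 2)" "n - i = n - i - 2 + 2" "i = i - 1 + 1"
        using that n by auto
      then show ?thesis
        using degree_W_poly_summand[of "n - i - 2" "i - 1"] unfolding f_def
        by (metis add_2_eq_Suc' Suc_eq_plus1)
    qed
    have deg_f1: "2 * degree (f 1) = (m + 1) * (m + 2)"
      using deg_f[of 1] n by simp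
    have less: "degree (f i) < degree (f 1)" if i: "i \<in> {2..(n - 1) div 2}" for i
    proof -
      have "i \<ge> 2" "2 * i \<le> m + 2"
        using i n by auto
      \<comment> \<open>The slack variables \<open>b\<close> and \<open>c\<close> remove all
        subtractions; the inequality then holds coefficient by coefficient, with a larger constant
        term on the right.\<close>
      define b where "b = i - 2"
      define c where "c = m + 2 - 2 * i"
      have "i = b + 2" "m = c + 2 * b + 2"
        using \<open>i \<ge> 2\<close> \<open>2 * i \<le> m + 2\<close> by (auto simp: b_def c_def)
      then have "2 * degree (f i) < 2 * degree (f 1)"
        unfolding deg_f1 using deg_f[of i] i n by (simp add: algebra_simps)
      then show ?thesis by simp
    qed
    \<comment> \<open>A strict degree bound on a sum needs this, since the empty sum has degree 0;
      it also gives \<open>W_poly n \<noteq> 0\<close>.\<close>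
    have deg_f1_pos: "0 < degree (f 1)"
      using deg_f1 by (cases "degree (f 1)") auto
    have "degree (2 * (\<Sum>i=2..(n - 1) div 2. f i)) < degree (f 1)"
      unfolding numeral degree_smult_eq using deg_f1_pos less
      by (auto intro!: degree_sum_less)
    moreover have "degree ((S_poly ((n - 2) div 2))\<^sup>2) < degree (f 1)"
    proof -
      define h where "h = (n - 2) div 2"
      have h: "2 * h \<le> m + 1"
        using n by (simp add: h_def)
      have "2 * degree ((S_poly h)\<^sup>2) = 2 * (h * (h + 1))"
        using degree_S_poly[of h] by (simp add: power2_eq_square degree_mult_eq)
      also have "\<dots> = 2 * h * (h + 1)" by simp
      also have "\<dots> \<le> (m + 1) * (h + 1)"
        using h by (intro mult_right_mono) auto
      also have "\<dots> < (m + 1) * (m + 2)"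
        using h by (intro mult_strict_left_mono) auto
      finally show ?thesis
        using deg_f1 by (simp add: h_def)
    qed
    ultimately have "degree r < degree (2 * f 1)"
      unfolding r_def numeral degree_smult_eq by (simp add: degree_add_less)
    then have "degree (W_poly n) = degree (f 1)"
      unfolding W by (subst degree_add_eq_left) (simp_all add: numeral)
    then show ?thesis
      using deg_f1 deg_f1_pos n by (auto simp: mult.commute)
  qed
  then show "W_poly n \<noteq> 0" "2 * degree (W_poly n) = (n - 2) * (n - 1)"
    by auto
qed

section \<open>Sums of largest odd divisors\<close>

lemma Od_odd:
  assumes "odd k"
  shows "Od k = k"
  unfolding Od_def
proof (rule Max_eqI)
  show "finite {d. odd d \<and> d dvd k}"
    using assms by (intro finite_subset[OF _ finite_divisors_nat[of k]]) (auto simp: odd_pos)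
qed (use assms in \<open>auto intro!: dvd_imp_le odd_pos\<close>)

lemma Od_double: "Od (2 * k) = Od k"
proof -
  have "{d. odd d \<and> d dvd 2 * k} = {d. odd d \<and> d dvd k}"
    by (auto simp: coprime_dvd_mult_right_iff)
  then show ?thesis
    by (simp add: Od_def)
qed

text \<open>The odd k up to 2r are their own largest odd divisors and sum to r^2; the even ones
  reduce to 1, ..., r by halving.\<close>

lemma sum_Od_double: "(\<Sum>k=1..2 * r. Od k) = r\<^sup>2 + (\<Sum>k=1..r. Od k)"
proof (induction r)
  case (Suc r)
  have "Od (Suc (2 * r)) = Suc (2 * r)"
    by (simp add: Od_odd)
  moreover have "Od (Suc (Suc (2 * r))) = Od (Suc r)"
    using Od_double[of "Suc r"] by simp
  ultimately show ?case
    using Suc by (simp add: power2_eq_square)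
qed simp

text \<open>Passing from m to r = \<open>m div 2\<close> splits off r(r+1) from twice the degree and
  2r^2, plus 2m for odd m, from twice the sum. With r(r+1) from the induction hypothesis this makes
  m(m+1).\<close>

lemma sum_Od: "2 * (\<Sum>k=1..m. Od k) + 2 * degree (S_prod m) = m * (m + 1)"
proof (induction m rule: less_induct)
  case (less m)
  show ?case
  proof (cases "m = 0")
    case True
    then show ?thesis by (simp add: S_prod_def)
  next
    case False
    define r where "r = m div 2"
    have "2 * degree (S_prod m) = r * (r + 1) + 2 * degree (S_prod r)"
      using False degree_S_poly[of r] by (simp add: S_prod_rec[of m] degree_mult_eq flip: r_def)
    moreover have "2 * (\<Sum>k=1..r. Od k) + 2 * degree (S_prod r) = r * (r + 1)"
      using False by (intro less) (simp add: r_def)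
    moreover have "(\<Sum>k=1..m. Od k) = (if even m then 0 else m) + r\<^sup>2 + (\<Sum>k=1..r. Od k)"
    proof (cases "even m")
      case True
      then show ?thesis
        using sum_Od_double[of r] by (simp add: r_def)
    next
      case False
      then have "m = Suc (2 * r)"
        by (simp add: r_def)
      then show ?thesis
        using sum_Od_double[of r] False by (simp add: Od_odd)
    qed
    moreover have "m = (if even m then 2 * r else 2 * r + 1)"
      by (simp add: r_def)
    ultimately show ?thesis
      by (cases "even m") (auto simp: power2_eq_square algebra_simps)
  qed
qed

theorem theorem4:
  fixes n :: nat
  assumes "n \<ge> 2"
  shows "degree (P_poly n) = (\<Sum>k=1..n - 2. Od k)"
proof -
  have D: "D_poly n \<noteq> 0"
    by (simp add: D_poly_eq_S_prod)
  obtain Q where Q: "W_poly n = Q * D_poly n"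
    using D_poly_dvd_W_poly[of n] by (auto simp: dvd_def mult.commute)
  \<comment> \<open>Cancelling the nonzero \<open>D_poly n\<close> shows that the cofactor is
    unique, so the definite description denotes \<open>Q\<close>.\<close>
  have "P_poly n = Q"
    unfolding P_poly_def using Q D by (intro the_equality) auto
  moreover have "Q \<noteq> 0"
    using Q degree_W_poly(1)[OF assms] by auto
  then have "2 * degree Q + 2 * degree (D_poly n) = (n - 2) * (n - 1)"
    using Q D degree_W_poly(2)[OF assms] by (simp add: degree_mult_eq)
  moreover have "n - 2 + 1 = n - 1"
    using assms by simp
  ultimately show ?thesis
    using sum_Od[of "n - 2"] by (simp add: D_poly_eq_S_prod)
qed

end
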